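(* Let $G$ be a finite simple graph that contains a $4$-cycle $C_4$ as a subgraph, let $W$ be a graphon and let $p\in[0,1]$. If $\mathcal{N}(G,W)=\mathcal{N}(G,p)$, where $p$ denotes the constant graphon with value $p$, then $W\equiv p$, i.e. $W(x,y)=p$ for almost every $(x,y)\in[0,1]^2$.
   Context: A graphon is a symmetric measurable function $W:[0,1]^2\to[0,1]$. For a finite graph $S$ with vertex set $[n]$ and a graphon $W$, the sampling $\mathcal{G}(S,W)$ is the probability distribution on the (edge-)subgraphs $F$ of $S$ (same vertex set, subset of the edges) given by $\mathcal{G}(S,W)(F)=\int_{[0,1]^n}\prod_{\{i,j\}\in E(F)}W(x_i,x_j)\prod_{\{i,j\}\in E(S)\setminus E(F)}\big(1-W(x_i,x_j)\big)\,dx$; equivalently, choose $x_1,\dots,x_n$ independently uniformly in $[0,1]$ and keep each edge $\{i,j\}$ of $S$ independently with probability $W(x_i,x_j)$. Then $\mathcal{N}(S,W)$ is the distribution of the number of edges of this random subgraph: $\mathcal{N}(S,W)(k)=\sum_{F:\,|E(F)|=k}\mathcal{G}(S,W)(F)$. *)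

theory Defs
  imports "HOL-Probability.Probability"
begin

text \<open>Finite simple graphs on the vertex set \<open>{1..n}\<close>, given by their set of edges; an edge is a
  two-element set of vertices.\<close>

definition simple_graph :: "nat \<Rightarrow> nat set set \<Rightarrow> bool" where
  "simple_graph n E \<longleftrightarrow> (\<forall>e\<in>E. e \<subseteq> {1..n} \<and> card e = 2)"

definition contains_C4 :: "nat set set \<Rightarrow> bool" where
  "contains_C4 E \<longleftrightarrow>
     (\<exists>a b c d. distinct [a, b, c, d] \<and> {{a, b}, {b, c}, {c, d}, {d, a}} \<subseteq> E)"

text \<open>Measurable means Lebesgue measurable, which includes Borel measurable. Values of \<open>W\<close> outside
  the unit square are irrelevant and unconstrained.\<close>

definition graphon :: "(real \<Rightarrow> real \<Rightarrow> real) \<Rightarrow> bool" where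
  "graphon W \<longleftrightarrow>
     (\<lambda>(x, y). W x y) \<in> borel_measurable (lebesgue_on ({0..1} \<times> {0..1})) \<and>
     (\<forall>x\<in>{0..1}. \<forall>y\<in>{0..1}. W x y = W y x \<and> 0 \<le> W x y \<and> W x y \<le> 1)"

text \<open>Lebesgue measure on \<open>[0,1]\<^sup>n\<close>, with coordinates indexed by the vertices. The product of the
  Borel measures has to be completed: for Lebesgue measurable \<open>W\<close>, the function
  \<open>x \<mapsto> W (x i) (x j)\<close> need not be measurable with respect to the uncompleted product.\<close>

definition unit_cube :: "nat \<Rightarrow> (nat \<Rightarrow> real) measure" where
  "unit_cube n = completion (\<Pi>\<^sub>M i\<in>{1..n}. restrict_space lborel {0..1})"

text \<open>Each edge \<open>{i, j}\<close> is listed once, as the pair with \<open>i < j\<close>; the orientation is immaterial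
  because graphons are symmetric.\<close>

definition edge_pairs :: "nat set set \<Rightarrow> (nat \<times> nat) set" where
  "edge_pairs F = {(i, j). i < j \<and> {i, j} \<in> F}"

text \<open>The probability of the subgraph with edge set \<open>F\<close>; meaningful for \<open>F \<subseteq> E\<close> only.\<close>

definition sampling :: "nat \<Rightarrow> nat set set \<Rightarrow> (real \<Rightarrow> real \<Rightarrow> real) \<Rightarrow> nat set set \<Rightarrow> real" where
  "sampling n E W F =
     (\<integral>x. (\<Prod>(i, j)\<in>edge_pairs F. W (x i) (x j)) *
          (\<Prod>(i, j)\<in>edge_pairs (E - F). 1 - W (x i) (x j)) \<partial>unit_cube n)"

definition edge_count :: "nat \<Rightarrow> nat set set \<Rightarrow> (real \<Rightarrow> real \<Rightarrow> real) \<Rightarrow> nat \<Rightarrow> real" where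
  "edge_count n E W k = (\<Sum>F | F \<subseteq> E \<and> card F = k. sampling n E W F)"

end

theory Submission imports Defs begin

text \<open>Put \<open>W = p + U\<close> and write \<open>t(F, U)\<close> for the homomorphism density of \<open>F\<close> in the signed kernel \<open>U\<close>.
  In terms of the generating function of the edge count, the hypothesis says
  \<open>\<integral> \<Prod>\<^sub>e (1 + s U\<^sub>e) = 1\<close> for all small \<open>s \<ge> 0\<close>, so for every \<open>k \<ge> 1\<close> the sum of \<open>t(F, U)\<close> over
  the subgraphs \<open>F\<close> with \<open>k\<close> edges vanishes. For \<open>k = 2\<close> all summands are nonnegative and a
  path with two edges contributes \<open>\<integral> deg\<^sup>2\<close>, where \<open>deg x = \<integral> U(x, y) dy\<close>; hence \<open>deg = 0\<close> almost
  everywhere, and \<open>t(F, U) = 0\<close> whenever \<open>F\<close> has a vertex of degree one. The only graphs with four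
  edges and no such vertex are the 4-cycles, so for \<open>k = 4\<close> only terms
  \<open>t(C\<^sub>4, U) = \<integral>\<integral> codeg\<^sup>2 \<ge> 0\<close> remain. Thus \<open>codeg(y, z) = \<integral> U(x, y) U(x, z) dx\<close> vanishes almost everywhere;
  integrated over \<open>A \<times> A\<close> this gives \<open>\<integral>\<^sub>A U(x, y) dy = 0\<close> for almost every \<open>x\<close>, whence \<open>U = 0\<close>.\<close>

subsection \<open>Measure theory\<close>

text \<open>Fubini in a single coordinate, in a form that keeps the index set \<open>I\<close>, so
  that vertices can be averaged out one after another over the same product. The inner average
  ignores coordinate \<open>v\<close>, so integrating it over \<open>I\<close> or over
  \<open>I - {v}\<close> gives the same value.\<close>

lemma (in prob_space) integral_PiM_resample:
  fixes f :: "('i \<Rightarrow> 'a) \<Rightarrow> real"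
  assumes fin: "finite I" and v: "v \<in> I"
    and f[measurable]: "f \<in> borel_measurable (\<Pi>\<^sub>M i\<in>I. M)" and bnd: "\<And>x. \<bar>f x\<bar> \<le> B"
  shows "(\<integral>x. f x \<partial>(\<Pi>\<^sub>M i\<in>I. M)) = (\<integral>x. (\<integral>y. f (x(v := y)) \<partial>M) \<partial>(\<Pi>\<^sub>M i\<in>I. M))"
proof -
  interpret PI: product_prob_space "\<lambda>_. M" I
    by unfold_locales
  define J where "J = I - {v}"
  have J: "finite J" "v \<notin> J" "insert v J = I" using fin v by (auto simp: J_def)
  define g where "g x = (\<integral>y. f (x(v := y)) \<partial>M)" for x
  have upd: "(\<lambda>z. (fst z)(v := snd z)) \<in> (\<Pi>\<^sub>M i\<in>I. M) \<Otimes>\<^sub>M M \<rightarrow>\<^sub>M (\<Pi>\<^sub>M i\<in>I. M)"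
    using measurable_add_dim[of v I "\<lambda>_. M"] v by (simp add: insert_absorb case_prod_beta)
  have fupd: "(\<lambda>z. f ((fst z)(v := snd z))) \<in> borel_measurable ((\<Pi>\<^sub>M i\<in>I. M) \<Otimes>\<^sub>M M)"
    by (rule measurable_compose[OF upd f])
  have g[measurable]: "g \<in> borel_measurable (\<Pi>\<^sub>M i\<in>I. M)"
    unfolding g_def using fupd
    by - (rule borel_measurable_lebesgue_integral, simp add: case_prod_beta)
  have "0 \<le> B" using bnd[of undefined] by linarith
  \<comment> \<open>Here \<open>x\<close> is arbitrary and may lie outside the product space, where
    the slice can fail to be integrable; its integral is then 0 by convention, and the bound
    persists.\<close>
  have gb: "\<bar>g x\<bar> \<le> B" for x
  proof (cases "integrable M (\<lambda>y. f (x(v := y)))")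
    case True
    have "\<bar>g x\<bar> \<le> (\<integral>y. \<bar>f (x(v := y))\<bar> \<partial>M)" unfolding g_def by (rule integral_abs_bound)
    also have "\<dots> \<le> (\<integral>y. B \<partial>M)" using True bnd by (intro integral_mono) auto
    finally show ?thesis by (simp add: prob_space)
  next
    case False then show ?thesis using \<open>0 \<le> B\<close> by (simp add: g_def not_integrable_integral_eq)
  qed
  have intf: "integrable (\<Pi>\<^sub>M i\<in>I. M) f"
    using bnd by (intro PI.P.integrable_const_bound[where B = B]) auto
  have intg: "integrable (\<Pi>\<^sub>M i\<in>I. M) g"
    using gb by (intro PI.P.integrable_const_bound[where B = B]) auto
  have "(\<integral>x. g x \<partial>(\<Pi>\<^sub>M i\<in>I. M)) = (\<integral>x. (\<integral>y. g (x(v := y)) \<partial>M) \<partial>(\<Pi>\<^sub>M i\<in>J. M))"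
    using PI.product_integral_insert[OF J(1,2), of g] intg J(3) by simp
  also have "\<dots> = (\<integral>x. g x \<partial>(\<Pi>\<^sub>M i\<in>J. M))"
    by (simp add: g_def prob_space)
  also have "\<dots> = (\<integral>x. f x \<partial>(\<Pi>\<^sub>M i\<in>I. M))"
    using PI.product_integral_insert[OF J(1,2), of f] intf J(3) by (simp add: g_def)
  finally show ?thesis by (simp add: g_def)
qed

text \<open>Transports null sets of pairs to null sets of the cube: a property of almost every pair
  holds at the endpoints of a fixed edge for almost every point. It suffices to compare the measures
  on rectangles.\<close>

lemma (in prob_space) distr_PiM_two_components:
  assumes "i \<in> I" "j \<in> I" "i \<noteq> j"
  shows "distr (\<Pi>\<^sub>M i\<in>I. M) (M \<Otimes>\<^sub>M M) (\<lambda>x. (x i, x j)) = M \<Otimes>\<^sub>M M"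
proof (rule pair_measure_eqI[symmetric])
  interpret PI: product_prob_space "\<lambda>_. M" I
    by unfold_locales
  show "sigma_finite_measure M" "sigma_finite_measure M" by unfold_locales
  fix A B assume [measurable]: "A \<in> sets M" "B \<in> sets M"
  have *: "(\<lambda>x. (x i, x j)) -` (A \<times> B) \<inter> space (\<Pi>\<^sub>M i\<in>I. M) =
    {x \<in> space (\<Pi>\<^sub>M i\<in>I. M). \<forall>k\<in>{i, j}. x k \<in> (if k = i then A else B)}"
    using assms by auto
  have "emeasure (distr (\<Pi>\<^sub>M i\<in>I. M) (M \<Otimes>\<^sub>M M) (\<lambda>x. (x i, x j))) (A \<times> B) =
    emeasure (\<Pi>\<^sub>M i\<in>I. M) {x \<in> space (\<Pi>\<^sub>M i\<in>I. M). \<forall>k\<in>{i, j}. x k \<in> (if k = i then A else B)}"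
    using assms * by (subst emeasure_distr) (auto intro!: measurable_Pair measurable_component_singleton)
  also have "\<dots> = (\<Prod>k\<in>{i, j}. emeasure M (if k = i then A else B))"
    using assms by (intro PI.emeasure_PiM_Collect) auto
  also have "\<dots> = emeasure M A * emeasure M B"
    using assms by simp
  finally show "emeasure M A * emeasure M B =
    emeasure (distr (\<Pi>\<^sub>M i\<in>I. M) (M \<Otimes>\<^sub>M M) (\<lambda>x. (x i, x j))) (A \<times> B)" ..
qed simp

text \<open>The measures agree on rectangles. For the sigma-algebras, one inclusion is checked on
  generating rectangles; for the other, the inclusion map into the full product is measurable and
  \<open>X\<close> is its own preimage.\<close>

lemma pair_restrict_space:
  assumes A: "A \<in> sets M" and B: "B \<in> sets N"
    and "sigma_finite_measure M" "sigma_finite_measure N"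
  shows "restrict_space M A \<Otimes>\<^sub>M restrict_space N B = restrict_space (M \<Otimes>\<^sub>M N) (A \<times> B)"
proof (rule pair_measure_eqI)
  interpret N: sigma_finite_measure N by fact
  note [measurable] = A B
  show "sigma_finite_measure (restrict_space M A)" "sigma_finite_measure (restrict_space N B)"
    using assms by (auto intro: sigma_finite_measure_restrict_space)
  show "sets (restrict_space M A \<Otimes>\<^sub>M restrict_space N B) = sets (restrict_space (M \<Otimes>\<^sub>M N) (A \<times> B))"
  proof (intro equalityI subsetI)
    have sp: "space (restrict_space M A) \<times> space (restrict_space N B) = A \<times> B"
      using sets.sets_into_space[OF A] sets.sets_into_space[OF B]
      by (auto simp: space_restrict_space)
    have spr: "space (restrict_space (M \<Otimes>\<^sub>M N) (A \<times> B)) = A \<times> B"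
      using A B by (simp add: space_restrict_space2)
    fix X assume "X \<in> sets (restrict_space M A \<Otimes>\<^sub>M restrict_space N B)"
    then have "X \<in> sigma_sets (A \<times> B) {a \<times> b | a b. a \<in> sets (restrict_space M A) \<and> b \<in> sets (restrict_space N B)}"
      unfolding sets_pair_measure sp .
    moreover have "{a \<times> b | a b. a \<in> sets (restrict_space M A) \<and> b \<in> sets (restrict_space N B)}
      \<subseteq> sets (restrict_space (M \<Otimes>\<^sub>M N) (A \<times> B))"
      using A B by (auto simp: sets_restrict_space_iff)
    ultimately show "X \<in> sets (restrict_space (M \<Otimes>\<^sub>M N) (A \<times> B))"
      using sets.sigma_sets_subset[of _ "restrict_space (M \<Otimes>\<^sub>M N) (A \<times> B)"] spr by auto
  next
    fix X assume "X \<in> sets (restrict_space (M \<Otimes>\<^sub>M N) (A \<times> B))"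
    then have X: "X \<in> sets (M \<Otimes>\<^sub>M N)" "X \<subseteq> A \<times> B"
      using A B by (auto simp: sets_restrict_space_iff)
    have "(\<lambda>z. (fst z, snd z)) \<in> restrict_space M A \<Otimes>\<^sub>M restrict_space N B \<rightarrow>\<^sub>M M \<Otimes>\<^sub>M N"
      by (intro measurable_Pair measurable_compose[OF measurable_fst measurable_restrict_space1]
        measurable_compose[OF measurable_snd measurable_restrict_space1]) auto
    from measurable_sets[OF this X(1)]
    have "X \<inter> space (restrict_space M A \<Otimes>\<^sub>M restrict_space N B) \<in> sets (restrict_space M A \<Otimes>\<^sub>M restrict_space N B)"
      by (simp add: vimage_def Int_def)
    moreover have "X \<inter> space (restrict_space M A \<Otimes>\<^sub>M restrict_space N B) = X"
      using X A B by (auto simp: space_pair_measure space_restrict_space2)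
    ultimately show "X \<in> sets (restrict_space M A \<Otimes>\<^sub>M restrict_space N B)" by simp
  qed
  fix X Y assume X: "X \<in> sets (restrict_space M A)" and Y: "Y \<in> sets (restrict_space N B)"
  then have "X \<in> sets M" "X \<subseteq> A" "Y \<in> sets N" "Y \<subseteq> B"
    using A B by (auto simp: sets_restrict_space_iff)
  then show "emeasure (restrict_space M A) X * emeasure (restrict_space N B) Y =
    emeasure (restrict_space (M \<Otimes>\<^sub>M N) (A \<times> B)) (X \<times> Y)"
    using A B by (subst (1 2 3) emeasure_restrict_space) (auto simp: N.emeasure_pair_measure_Times)
qed

text \<open>Preimages under \<open>f\<close> and \<open>g\<close> differ by a subset of a null set,
  which the completion makes measurable.\<close>

lemma measurable_completion_AE:
  fixes f :: "'a \<Rightarrow> real"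
  assumes f: "f \<in> borel_measurable M" and ae: "AE x in M. f x = g x"
  shows "g \<in> borel_measurable (completion M)"
proof (rule measurableI)
  fix A :: "real set" assume A: "A \<in> sets borel"
  show "g -` A \<inter> space (completion M) \<in> sets (completion M)"
  proof (rule completion.in_sets_AE)
    show "AE x in completion M. x \<in> f -` A \<inter> space M \<longleftrightarrow> x \<in> g -` A \<inter> space (completion M)"
      using AE_completion[OF ae] by eventually_elim auto
    show "f -` A \<inter> space M \<in> sets (completion M)"
      using measurable_sets[OF f A] by auto
  qed auto
qed simp

text \<open>Moves integrals over the completed cube to the plain product, where the Fubini arguments
  take place.\<close>

lemma integral_completion_AE:
  fixes f :: "'a \<Rightarrow> real"
  assumes f: "f \<in> borel_measurable M" and ae: "AE x in M. f x = g x"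
  shows "(\<integral>x. g x \<partial>completion M) = (\<integral>x. f x \<partial>M)"
proof -
  have "(\<integral>x. g x \<partial>completion M) = (\<integral>x. f x \<partial>completion M)"
    using AE_completion[OF ae]
    by (intro integral_cong_AE measurable_completion_AE[OF f ae] measurable_completion f)
       (auto elim: eventually_mono)
  then show ?thesis using integral_completion[OF f] by simp
qed

subsection \<open>Homomorphism densities of signed kernels\<close>

lemma abs_mult_le_1: "\<bar>a\<bar> \<le> 1 \<Longrightarrow> \<bar>b\<bar> \<le> 1 \<Longrightarrow> \<bar>a * b\<bar> \<le> (1 :: real)"
  by (simp add: abs_mult mult_le_one)

lemma abs_prod_le_1: "(\<And>e. e \<in> F \<Longrightarrow> \<bar>f e\<bar> \<le> 1) \<Longrightarrow> \<bar>\<Prod>e\<in>F. f e\<bar> \<le> (1 :: real)"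
  by (simp add: abs_prod prod_le_1)

text \<open>Ordering the endpoints makes this a function of the edge for any \<open>U\<close>,
  symmetric or not, so that products can range over sets of edges.\<close>

definition edge_val :: "('a \<Rightarrow> 'a \<Rightarrow> 'b) \<Rightarrow> (nat \<Rightarrow> 'a) \<Rightarrow> nat set \<Rightarrow> 'b" where
  "edge_val U x e = U (x (Min e)) (x (Max e))"

lemma edge_val_doubleton:
  assumes "\<And>s t. U s t = U t s"
  shows "edge_val U x {a, b} = U (x a) (x b)"
  using assms by (cases "a \<le> b") (auto simp: edge_val_def)

lemma edge_val_upd:
  assumes "card e = 2" "v \<notin> e"
  shows "edge_val U (x(v := y)) e = edge_val U x e"
proof -
  have "finite e" "e \<noteq> {}" using assms by (auto intro: card_ge_0_finite)
  then have "Min e \<in> e" "Max e \<in> e" by auto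
  then have "Min e \<noteq> v" "Max e \<noteq> v" using assms by auto
  then show ?thesis by (simp add: edge_val_def)
qed

text \<open>Symmetry and the bound hold at every point, not just almost everywhere, so all products
  and averages of \<open>U\<close> are bounded by 1 and measurability alone yields
  integrability.\<close>

locale symmetric_kernel = prob_space M for M :: "'a measure" +
  fixes U :: "'a \<Rightarrow> 'a \<Rightarrow> real" and I :: "nat set"
  assumes U_meas[measurable]: "(\<lambda>(x, y). U x y) \<in> borel_measurable (M \<Otimes>\<^sub>M M)"
    and U_sym: "U x y = U y x"
    and U_bound: "\<bar>U x y\<bar> \<le> 1"
    and finite_I: "finite I"
begin

sublocale pair: pair_prob_space M M
  by unfold_locales

sublocale PI: product_prob_space "\<lambda>_. M" I
  by unfold_locales

abbreviation vertex_space :: "(nat \<Rightarrow> 'a) measure" where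
  "vertex_space \<equiv> \<Pi>\<^sub>M i\<in>I. M"

definition deg :: "'a \<Rightarrow> real" where
  "deg x = (\<integral>y. U x y \<partial>M)"

definition codeg :: "'a \<Rightarrow> 'a \<Rightarrow> real" where
  "codeg y z = (\<integral>x. U x y * U x z \<partial>M)"

definition hom_density :: "nat set set \<Rightarrow> real" where
  "hom_density F = (\<integral>x. (\<Prod>e\<in>F. edge_val U x e) \<partial>vertex_space)"

lemmas edge_val_pair = edge_val_doubleton[of U, OF U_sym]

lemma deg_meas[measurable]: "deg \<in> borel_measurable M"
  unfolding deg_def by measurable

lemma codeg_meas[measurable]: "(\<lambda>(y, z). codeg y z) \<in> borel_measurable (M \<Otimes>\<^sub>M M)"
  unfolding codeg_def by measurable

lemma abs_integral_le_1:
  assumes "\<And>y. \<bar>f y\<bar> \<le> (1 :: real)"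
  shows "\<bar>\<integral>y. f y \<partial>M\<bar> \<le> 1"
proof (cases "integrable M f")
  case True
  have "\<bar>\<integral>y. f y \<partial>M\<bar> \<le> (\<integral>y. \<bar>f y\<bar> \<partial>M)" by (rule integral_abs_bound)
  also have "\<dots> \<le> (\<integral>y. 1 \<partial>M)" using True assms by (intro integral_mono) auto
  finally show ?thesis by (simp add: prob_space)
qed (simp add: not_integrable_integral_eq)

lemma deg_bound: "\<bar>deg x\<bar> \<le> 1"
  unfolding deg_def by (rule abs_integral_le_1) (rule U_bound)

lemma codeg_bound: "\<bar>codeg y z\<bar> \<le> 1"
  unfolding codeg_def by (intro abs_integral_le_1 abs_mult_le_1 U_bound)

lemma edge_val_bound: "\<bar>edge_val U x e\<bar> \<le> 1"
  by (simp add: edge_val_def U_bound)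

lemma edge_val_meas:
  assumes "e \<subseteq> I" "card e = 2"
  shows "(\<lambda>x. edge_val U x e) \<in> borel_measurable vertex_space"
proof -
  have "finite e" "e \<noteq> {}" using assms by (auto intro: card_ge_0_finite)
  then have [measurable]: "Min e \<in> I" "Max e \<in> I" using assms Min_in Max_in by blast+
  show ?thesis unfolding edge_val_def by measurable
qed

lemma resample:
  fixes f :: "(nat \<Rightarrow> 'a) \<Rightarrow> real"
  assumes "v \<in> I" "f \<in> borel_measurable vertex_space" "\<And>x. \<bar>f x\<bar> \<le> 1"
  shows "(\<integral>x. f x \<partial>vertex_space) = (\<integral>x. (\<integral>y. f (x(v := y)) \<partial>M) \<partial>vertex_space)"
  by (rule integral_PiM_resample[OF finite_I assms])

lemma integrable_vertex_space:
  fixes f :: "(nat \<Rightarrow> 'a) \<Rightarrow> real"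
  assumes "f \<in> borel_measurable vertex_space" "\<And>x. \<bar>f x\<bar> \<le> 1"
  shows "integrable vertex_space f"
  using assms by (intro PI.P.integrable_const_bound[where B = 1]) auto

lemma integral_vertex:
  fixes f :: "'a \<Rightarrow> real"
  assumes "b \<in> I" "f \<in> borel_measurable M"
  shows "(\<integral>x. f (x b) \<partial>vertex_space) = (\<integral>y. f y \<partial>M)"
proof -
  have "(\<integral>y. f y \<partial>M) = (\<integral>y. f y \<partial>distr vertex_space M (\<lambda>x. x b))"
    using PI.PiM_component[OF assms(1)] by simp
  also have "\<dots> = (\<integral>x. f (x b) \<partial>vertex_space)"
    using assms by (intro integral_distr) auto
  finally show ?thesis ..
qed

section \<open>Densities of small graphs\<close>

text \<open>Each of the ends \<open>a\<close> and \<open>c\<close> lies on one edge only, so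
  averaging it out turns that edge into a factor \<open>deg (x b)\<close>.\<close>

lemma hom_density_cherry:
  assumes [measurable]: "a \<in> I" "b \<in> I" "c \<in> I" and d: "distinct [a, b, c]"
  shows "hom_density {{a, b}, {b, c}} = (\<integral>y. (deg y)\<^sup>2 \<partial>M)"
proof -
  have "hom_density {{a, b}, {b, c}} = (\<integral>x. U (x b) (x a) * U (x b) (x c) \<partial>vertex_space)"
    using assms unfolding hom_density_def
    by (intro Bochner_Integration.integral_cong) (auto simp: edge_val_pair doubleton_eq_iff U_sym)
  also have "\<dots> = (\<integral>x. deg (x b) * U (x b) (x c) \<partial>vertex_space)"
    using assms by (subst resample[of a]) (auto intro!: abs_mult_le_1 U_bound simp: deg_def)
  also have "\<dots> = (\<integral>x. deg (x b) * deg (x b) \<partial>vertex_space)"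
    using assms by (subst resample[of c]) (auto intro!: abs_mult_le_1 U_bound deg_bound simp: deg_def[symmetric])
  also have "\<dots> = (\<integral>y. (deg y)\<^sup>2 \<partial>M)"
    using assms by (subst integral_vertex[of b "\<lambda>y. deg y * deg y"]) (auto simp: power2_eq_square)
  finally show ?thesis .
qed

lemma hom_density_two_disjoint_edges:
  assumes [measurable]: "a \<in> I" "b \<in> I" "c \<in> I" "d \<in> I" and d: "distinct [a, b, c, d]"
  shows "hom_density {{a, b}, {c, d}} = (\<integral>y. deg y \<partial>M)\<^sup>2"
proof -
  have "hom_density {{a, b}, {c, d}} = (\<integral>x. U (x b) (x a) * U (x c) (x d) \<partial>vertex_space)"
    using assms unfolding hom_density_def
    by (intro Bochner_Integration.integral_cong) (auto simp: edge_val_pair doubleton_eq_iff U_sym)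
  also have "\<dots> = (\<integral>x. deg (x b) * U (x c) (x d) \<partial>vertex_space)"
    using assms by (subst resample[of a]) (auto intro!: abs_mult_le_1 U_bound simp: deg_def)
  also have "\<dots> = (\<integral>x. deg (x b) * deg (x c) \<partial>vertex_space)"
    using assms by (subst resample[of d]) (auto intro!: abs_mult_le_1 U_bound deg_bound simp: deg_def[symmetric])
  also have "\<dots> = (\<integral>x. (\<integral>y. deg y \<partial>M) * deg (x c) \<partial>vertex_space)"
    using assms by (subst resample[of b]) (auto intro!: abs_mult_le_1 deg_bound)
  also have "\<dots> = (\<integral>y. deg y \<partial>M)\<^sup>2"
    by (simp add: integral_vertex[OF assms(3) deg_meas] power2_eq_square)
  finally show ?thesis .
qed

text \<open>The opposite vertices \<open>a\<close> and \<open>c\<close> both have neighbours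
  \<open>b\<close> and \<open>d\<close>; averaging out each of them produces one factor
  \<open>codeg (x b) (x d)\<close>.\<close>

lemma hom_density_C4:
  assumes [measurable]: "a \<in> I" "b \<in> I" "c \<in> I" "d \<in> I" and d: "distinct [a, b, c, d]"
  shows "hom_density {{a, b}, {b, c}, {c, d}, {d, a}} = (\<integral>x. (codeg (x b) (x d))\<^sup>2 \<partial>vertex_space)"
proof -
  have "hom_density {{a, b}, {b, c}, {c, d}, {d, a}} =
      (\<integral>x. (U (x a) (x b) * U (x a) (x d)) * (U (x c) (x b) * U (x c) (x d)) \<partial>vertex_space)"
    using assms unfolding hom_density_def
    by (intro Bochner_Integration.integral_cong)
       (auto simp: edge_val_pair doubleton_eq_iff U_sym[of _ "x a" for x] U_sym[of "x b" "x c" for x])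
  also have "\<dots> = (\<integral>x. codeg (x b) (x d) * (U (x c) (x b) * U (x c) (x d)) \<partial>vertex_space)"
    using assms by (subst resample[of a]) (auto intro!: abs_mult_le_1 U_bound simp: codeg_def)
  also have "\<dots> = (\<integral>x. codeg (x b) (x d) * codeg (x b) (x d) \<partial>vertex_space)"
    using assms by (subst resample[of c]) (auto intro!: abs_mult_le_1 U_bound codeg_bound simp: codeg_def[symmetric])
  finally show ?thesis by (simp add: power2_eq_square)
qed

text \<open>The vertex \<open>v\<close> occurs in a single factor, so averaging it out leaves a
  factor \<open>deg (x b)\<close>, which vanishes almost surely.\<close>

lemma hom_density_pendant:
  assumes F: "finite F" "\<And>e. e \<in> F \<Longrightarrow> e \<subseteq> I \<and> card e = 2"
    and e: "{v, b} \<in> F" and uniq: "\<And>e. e \<in> F \<Longrightarrow> v \<in> e \<Longrightarrow> e = {v, b}"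
    and deg0: "AE y in M. deg y = 0"
  shows "hom_density F = 0"
proof -
  have vb: "v \<noteq> b" "v \<in> I" "b \<in> I" using F(2)[OF e] by auto
  define R where "R x = (\<Prod>e\<in>F - {{v, b}}. edge_val U x e)" for x
  have R_upd: "R (x(v := y)) = R x" for x y
    unfolding R_def using F uniq by (intro prod.cong refl edge_val_upd) auto
  have R_meas: "R \<in> borel_measurable vertex_space"
    unfolding R_def using F by (intro borel_measurable_prod edge_val_meas) auto
  have R_bound: "\<bar>R x\<bar> \<le> 1" for x
    unfolding R_def by (intro abs_prod_le_1 edge_val_bound)
  note [measurable] = R_meas vb(2,3)
  have "hom_density F = (\<integral>x. U (x b) (x v) * R x \<partial>vertex_space)"
    unfolding hom_density_def R_def
    by (subst prod.remove[OF F(1) e]) (simp add: edge_val_pair U_sym[of _ "x b" for x])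
  also have "\<dots> = (\<integral>x. deg (x b) * R x \<partial>vertex_space)"
    using vb by (subst resample[of v]) (auto intro!: abs_mult_le_1 U_bound R_bound simp: deg_def R_upd)
  also have "\<dots> = (\<integral>x. 0 \<partial>vertex_space)"
  proof (rule integral_cong_AE)
    show "AE x in vertex_space. deg (x b) * R x = 0"
      using PI.AE_component[OF vb(3) deg0] by eventually_elim simp
  qed auto
  finally show ?thesis by simp
qed

text \<open>The three indices supply independent points: \<open>a\<close> for the first argument of
  \<open>U\<close>, and \<open>b\<close>, \<open>c\<close> for two copies of the second. The null
  set in \<open>slice\<close> depends on \<open>A\<close>; comparing measures on rectangles avoids
  having to treat all \<open>A\<close> at one \<open>x\<close>.\<close>

lemma AE_zero_if_codeg_zero:
  assumes I: "a \<in> I" "b \<in> I" "c \<in> I" "distinct [a, b, c]"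
    and cod: "AE x in vertex_space. codeg (x b) (x c) = 0"
  shows "AE z in M \<Otimes>\<^sub>M M. U (fst z) (snd z) = 0"
proof -
  note [measurable] = I(1-3)
  have slice: "AE x in M. (\<integral>y. indicator A y * U x y \<partial>M) = 0" if [measurable]: "A \<in> sets M" for A
  proof -
    define h where "h x = (\<integral>y. indicator A y * U x y \<partial>M)" for x
    have [measurable]: "h \<in> borel_measurable M" unfolding h_def by measurable
    have iU: "\<bar>indicator A y * U x y\<bar> \<le> 1" for x y
      using U_bound by (auto simp: indicator_def)
    have hb: "\<bar>h x\<bar> \<le> 1" for x unfolding h_def by (intro abs_integral_le_1 iU)
    \<comment> \<open>The two factors of the square are unfolded as averages over separate
      coordinates \<open>b\<close> and \<open>c\<close>; averaging over \<open>a\<close> first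
      instead exhibits the codegree.\<close>
    have "(\<integral>x. (h x)\<^sup>2 \<partial>M) = (\<integral>x. h (x a) * h (x a) \<partial>vertex_space)"
      using I by (subst integral_vertex[of a "\<lambda>y. h y * h y"]) (auto simp: power2_eq_square)
    also have "\<dots> = (\<integral>x. (indicator A (x b) * U (x a) (x b)) * h (x a) \<partial>vertex_space)"
      using I by (subst (2) resample[of b]) (auto intro!: abs_mult_le_1[OF iU hb[unfolded h_def]] simp: h_def)
    also have "\<dots> = (\<integral>x. (indicator A (x b) * U (x a) (x b)) * (indicator A (x c) * U (x a) (x c)) \<partial>vertex_space)"
      using I by (subst (2) resample[of c]) (auto intro!: abs_mult_le_1[OF iU iU] simp: h_def)
    also have "\<dots> = (\<integral>x. (indicator A (x b) * indicator A (x c)) * (U (x a) (x b) * U (x a) (x c)) \<partial>vertex_space)"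
      by (simp add: mult_ac)
    also have "\<dots> = (\<integral>x. (indicator A (x b) * indicator A (x c)) * codeg (x b) (x c) \<partial>vertex_space)"
      using I by (subst resample[of a]) (auto intro!: abs_mult_le_1 U_bound simp: codeg_def indicator_def)
    also have "\<dots> = (\<integral>x. 0 \<partial>vertex_space)"
      using cod by (intro integral_cong_AE) (auto elim: eventually_mono)
    finally have "(\<integral>x. (h x)\<^sup>2 \<partial>M) = 0" by simp
    moreover have "integrable M (\<lambda>x. (h x)\<^sup>2)"
      using hb by (intro integrable_const_bound[where B = 1]) (auto simp: abs_square_le_1)
    ultimately have "AE x in M. (h x)\<^sup>2 = 0"
      by (subst (asm) integral_nonneg_eq_0_iff_AE) auto
    then show ?thesis by (simp add: h_def)
  qed
  have nonneg: "0 \<le> 1 + U x y" for x y using U_bound[of x y] by linarith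
  \<comment> \<open>\<open>1 + U\<close> is a density, with respect to \<open>M \<Otimes> M\<close>, of a measure that agrees with \<open>M \<Otimes> M\<close> on rectangles.\<close>
  let ?D = "density (M \<Otimes>\<^sub>M M) (\<lambda>z. ennreal (1 + U (fst z) (snd z)))"
  have "M \<Otimes>\<^sub>M M = ?D"
  proof (rule pair_measure_eqI)
    show "sigma_finite_measure M" "sigma_finite_measure M" by unfold_locales
    fix A B assume [measurable]: "A \<in> sets M" "B \<in> sets M"
    have inner: "AE x in M. (\<integral>\<^sup>+y. ennreal (1 + U x y) * indicator (A \<times> B) (x, y) \<partial>M) =
        indicator A x * emeasure M B"
      using slice[OF \<open>B \<in> sets M\<close>] AE_space
    proof eventually_elim
      fix x assume 0: "(\<integral>y. indicator B y * U x y \<partial>M) = 0" and [measurable]: "x \<in> space M"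
      have i1: "integrable M (\<lambda>y. indicator B y * U x y)"
        using U_bound by (intro integrable_const_bound[where B = 1]) (auto simp: indicator_def)
      have i2: "integrable M (\<lambda>y. indicator B y + indicator B y * U x y)"
        using i1 by (intro Bochner_Integration.integrable_add) (auto simp: integrable_indicator_iff less_top[symmetric])
      have "(\<integral>\<^sup>+y. ennreal (1 + U x y) * indicator (A \<times> B) (x, y) \<partial>M) =
         (\<integral>\<^sup>+y. indicator A x * ennreal (indicator B y + indicator B y * U x y) \<partial>M)"
        by (intro nn_integral_cong) (auto simp: indicator_def)
      also have "\<dots> = indicator A x * (\<integral>\<^sup>+y. ennreal (indicator B y + indicator B y * U x y) \<partial>M)"
        by (intro nn_integral_cmult) measurable
      also have "(\<integral>\<^sup>+y. ennreal (indicator B y + indicator B y * U x y) \<partial>M) =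
          ennreal (\<integral>y. indicator B y + indicator B y * U x y \<partial>M)"
        using i2 nonneg by (intro nn_integral_eq_integral) (auto simp: indicator_def)
      also have "(\<integral>y. indicator B y + indicator B y * U x y \<partial>M) = measure M B"
        using i1 0 by (subst Bochner_Integration.integral_add) (auto simp: integrable_indicator_iff less_top[symmetric])
      finally show "(\<integral>\<^sup>+y. ennreal (1 + U x y) * indicator (A \<times> B) (x, y) \<partial>M) = indicator A x * emeasure M B"
        by (simp add: emeasure_eq_measure)
    qed
    have "emeasure ?D (A \<times> B) = (\<integral>\<^sup>+z. ennreal (1 + U (fst z) (snd z)) * indicator (A \<times> B) z \<partial>(M \<Otimes>\<^sub>M M))"
      by (intro emeasure_density) (auto simp: case_prod_beta[symmetric])
    also have "\<dots> = (\<integral>\<^sup>+x. (\<integral>\<^sup>+y. ennreal (1 + U x y) * indicator (A \<times> B) (x, y) \<partial>M) \<partial>M)"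
      by (subst nn_integral_fst[symmetric]) auto
    also have "\<dots> = (\<integral>\<^sup>+x. indicator A x * emeasure M B \<partial>M)"
      by (intro nn_integral_cong_AE inner)
    also have "\<dots> = emeasure M A * emeasure M B"
      by (subst nn_integral_multc) auto
    finally show "emeasure M A * emeasure M B = emeasure ?D (A \<times> B)" ..
  qed simp
  then have "density (M \<Otimes>\<^sub>M M) (\<lambda>z. 1) = ?D" by (simp add: density_1)
  then have "AE z in M \<Otimes>\<^sub>M M. 1 = ennreal (1 + U (fst z) (snd z))"
    by (subst (asm) pair.P.density_unique_iff) auto
  then show ?thesis
  proof eventually_elim
    fix z assume "1 = ennreal (1 + U (fst z) (snd z))"
    then show "U (fst z) (snd z) = 0"
      using nonneg[of "fst z" "snd z"] by (simp add: ennreal_1[symmetric] del: ennreal_1)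
  qed
qed

end

subsection \<open>Subgraphs with two and with four edges\<close>

text \<open>Prolong an edge \<open>{a, b}\<close> at both ends, to \<open>c\<close> and to
  \<open>d\<close>. If \<open>c = d\<close>, the fourth edge leaves the triangle and has a vertex of
  degree one; otherwise \<open>c\<close> and \<open>d\<close> both need another edge, which must be
  the fourth.\<close>

lemma four_edges_no_pendant:
  assumes card_F: "card F = 4" and card_e: "\<And>e. e \<in> F \<Longrightarrow> card e = 2"
    and no_pendant: "\<And>v e. e \<in> F \<Longrightarrow> v \<in> e \<Longrightarrow> \<exists>e'\<in>F. v \<in> e' \<and> e' \<noteq> e"
  shows "\<exists>a b c d. distinct [a, b, c, d] \<and> F = {{a, b}, {b, c}, {c, d}, {d, a}}"
proof -
  have fin: "finite F" using card_F by (auto intro: card_ge_0_finite)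
  have other: "\<exists>w. w \<noteq> v \<and> w \<noteq> u \<and> {v, w} \<in> F" if uv: "{u, v} \<in> F" for u v
  proof -
    obtain e where e: "e \<in> F" "v \<in> e" "e \<noteq> {u, v}"
      using no_pendant[OF uv, of v] by auto
    obtain w where "e = {v, w}" "w \<noteq> v"
      using card_e[OF e(1)] e(2) by (auto simp: card_2_iff doubleton_eq_iff)
    then show ?thesis using e by (auto simp: insert_commute)
  qed
  obtain a b where ab: "{a, b} \<in> F" "a \<noteq> b"
    using card_F card_e by (metis card_2_iff card.empty all_not_in_conv zero_neq_numeral)
  obtain c where c: "{b, c} \<in> F" "c \<noteq> b" "c \<noteq> a" using other[OF ab(1)] by blast
  obtain d where d: "{a, d} \<in> F" "d \<noteq> a" "d \<noteq> b" using other[of b a] ab(1) by (auto simp: insert_commute)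
  \<comment> \<open>These three edges are distinct even when \<open>c = d\<close>, so exactly one
    edge remains.\<close>
  have "card (F - {{a, b}, {b, c}, {a, d}}) = 1"
    using ab c d by (subst card_Diff_subset) (auto simp: card_F card_insert_if doubleton_eq_iff)
  then obtain X where X: "F - {{a, b}, {b, c}, {a, d}} = {X}" by (auto simp: card_1_singleton_iff)
  then have F: "F = {{a, b}, {b, c}, {a, d}, X}" and X_new: "X \<notin> {{a, b}, {b, c}, {a, d}}"
    using ab c d by auto
  show ?thesis
  proof (cases "c = d")
    case True
    have "card X = 2" using card_e F by auto
    then obtain v w where vw: "X = {v, w}" "v \<noteq> w" by (auto simp: card_2_iff)
    have "\<exists>v. v \<in> X \<and> v \<notin> {a, b, c}"
      using X_new vw True by (auto simp: insert_commute)
    then obtain v where v: "v \<in> X" "v \<notin> {a, b, c}" by blast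
    have "\<exists>e'\<in>F. v \<in> e' \<and> e' \<noteq> X" using no_pendant[of X v] v F by blast
    then show ?thesis using v True F by auto
  next
    case False
    have "c \<in> X"
      using no_pendant[of "{b, c}" c] c d ab False F by auto
    moreover have "d \<in> X"
      using no_pendant[of "{a, d}" d] c d ab False F by auto
    moreover have "card X = 2" using card_e F by auto
    ultimately have "X = {c, d}" using False by (auto simp: card_2_iff)
    then have "F = {{a, b}, {b, c}, {c, d}, {d, a}}" using F by (auto simp: insert_commute)
    moreover have "distinct [a, b, c, d]" using ab(2) c(2,3) d(2,3) False by auto
    ultimately show ?thesis by blast
  qed
qed

section \<open>Vanishing density sums force the kernel to vanish\<close>

context symmetric_kernel
begin

text \<open>Nonnegative summands with sum 0 vanish individually. Two edges come first, because the
  resulting \<open>deg0\<close> is what makes the four-edge summands nonnegative.\<close>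

lemma AE_zero_if_hom_density_sums_zero:
  assumes E: "\<And>e. e \<in> E \<Longrightarrow> e \<subseteq> I \<and> card e = 2"
    and C4: "contains_C4 E"
    and sum2: "(\<Sum>F | F \<subseteq> E \<and> card F = 2. hom_density F) = 0"
    and sum4: "(\<Sum>F | F \<subseteq> E \<and> card F = 4. hom_density F) = 0"
  shows "AE z in M \<Otimes>\<^sub>M M. U (fst z) (snd z) = 0"
proof -
  have finE: "finite E"
    using E by (intro finite_subset[of E "Pow I"]) (auto simp: finite_I)
  then have fins: "finite {F. F \<subseteq> E \<and> card F = k}" for k
    by (rule rev_finite_subset[OF finite_Pow_iff[THEN iffD2]]) auto
  obtain a b c d where abcd: "distinct [a, b, c, d]" "{{a, b}, {b, c}, {c, d}, {d, a}} \<subseteq> E"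
    using C4 unfolding contains_C4_def by blast
  then have I: "a \<in> I" "b \<in> I" "c \<in> I" "d \<in> I" using E by auto
  have nonneg2: "0 \<le> hom_density F" if F: "F \<subseteq> E" "card F = 2" for F
  proof -
    obtain e f where ef: "F = {e, f}" "e \<noteq> f" using F(2) by (auto simp: card_2_iff)
    have e: "e \<subseteq> I" "card e = 2" and f: "f \<subseteq> I" "card f = 2" using E F(1) ef by auto
    obtain u v where uv: "e = {u, v}" "u \<noteq> v" using e by (auto simp: card_2_iff)
    show ?thesis
    proof (cases "e \<inter> f = {}")
      case True
      obtain s t where "f = {s, t}" "s \<noteq> t" using f by (auto simp: card_2_iff)
      then show ?thesis using ef e f uv True hom_density_two_disjoint_edges[of u v s t] by auto
    next
      case False
      then obtain y where y: "y \<in> e" "y \<in> f" by auto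
      obtain s where s: "e = {s, y}" "s \<noteq> y" using e(2) y(1) by (auto simp: card_2_iff)
      obtain t where t: "f = {y, t}" "t \<noteq> y" using f(2) y(2) by (auto simp: card_2_iff)
      have "hom_density F = (\<integral>y. (deg y)\<^sup>2 \<partial>M)"
        unfolding ef s t using ef s t e f by (intro hom_density_cherry) auto
      then show ?thesis by simp
    qed
  qed
  have "hom_density {{a, b}, {b, c}} = 0"
    using sum_nonneg_eq_0_iff[THEN iffD1, OF fins _ sum2] nonneg2 abcd
    by (auto simp: doubleton_eq_iff)
  then have "(\<integral>y. (deg y)\<^sup>2 \<partial>M) = 0"
    using hom_density_cherry[of a b c] I abcd(1) by simp
  moreover have "integrable M (\<lambda>y. (deg y)\<^sup>2)"
    using deg_bound by (intro integrable_const_bound[where B = 1]) (auto simp: abs_square_le_1)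
  ultimately have "AE y in M. (deg y)\<^sup>2 = 0"
    by (subst (asm) integral_nonneg_eq_0_iff_AE) auto
  then have deg0: "AE y in M. deg y = 0" by simp
  have nonneg4: "0 \<le> hom_density F" if F: "F \<subseteq> E" "card F = 4" for F
  proof (cases "\<exists>v e. e \<in> F \<and> v \<in> e \<and> (\<forall>e'\<in>F. v \<in> e' \<longrightarrow> e' = e)")
    case True
    then obtain v e where ve: "e \<in> F" "v \<in> e" "\<And>e'. e' \<in> F \<Longrightarrow> v \<in> e' \<Longrightarrow> e' = e" by blast
    have "card e = 2" using E F(1) ve(1) by auto
    then obtain w where w: "e = {v, w}" using ve(2) by (auto simp: card_2_iff)
    have "hom_density F = 0"
    proof (rule hom_density_pendant)
      show "finite F" by (rule finite_subset[OF F(1) finE])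
      show "{v, w} \<in> F" using ve(1) w by simp
      show "f \<subseteq> I \<and> card f = 2" if "f \<in> F" for f using E F(1) that by blast
      show "f = {v, w}" if "f \<in> F" "v \<in> f" for f using ve(3)[OF that] w by simp
    qed (rule deg0)
    then show ?thesis by simp
  next
    case False
    have "card e = 2" if "e \<in> F" for e using E F(1) that by blast
    moreover have "\<exists>e'\<in>F. v \<in> e' \<and> e' \<noteq> e" if "e \<in> F" "v \<in> e" for v e using False that by blast
    ultimately have "\<exists>s t u v. distinct [s, t, u, v] \<and> F = {{s, t}, {t, u}, {u, v}, {v, s}}"
      by (rule four_edges_no_pendant[OF F(2)])
    then obtain s t u v where stuv: "distinct [s, t, u, v]" "F = {{s, t}, {t, u}, {u, v}, {v, s}}"
      by blast
    then have "s \<in> I" "t \<in> I" "u \<in> I" "v \<in> I" using E F(1) by auto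
    then show ?thesis using hom_density_C4[of s t u v] stuv by simp
  qed
  have "hom_density {{a, b}, {b, c}, {c, d}, {d, a}} = 0"
    using sum_nonneg_eq_0_iff[THEN iffD1, OF fins _ sum4] nonneg4 abcd
    by (auto simp: doubleton_eq_iff)
  then have "(\<integral>x. (codeg (x b) (x d))\<^sup>2 \<partial>vertex_space) = 0"
    using hom_density_C4[of a b c d] I abcd(1) by simp
  moreover have "integrable vertex_space (\<lambda>x. (codeg (x b) (x d))\<^sup>2)"
    using codeg_bound I by (intro integrable_vertex_space) (auto simp: abs_square_le_1)
  ultimately have "AE x in vertex_space. (codeg (x b) (x d))\<^sup>2 = 0"
    by (subst (asm) integral_nonneg_eq_0_iff_AE) auto
  \<comment> \<open>The codegree involves the opposite vertices \<open>b\<close> and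
    \<open>d\<close> of the cycle; \<open>a\<close> serves as the third independent
    coordinate.\<close>
  then show ?thesis
    using I abcd(1) by (intro AE_zero_if_codeg_zero[of a b d]) auto
qed

section \<open>Generating function of the edge count\<close>

text \<open>Equal counts give equal generating functions. A change of variable turns them into a
  polynomial in \<open>s\<close> with the density sums as coefficients, equal to 1 on a whole
  interval, so all coefficients of positive degree are 0.\<close>

lemma hom_density_sum_eq_0:
  assumes E: "\<And>e. e \<in> E \<Longrightarrow> e \<subseteq> I \<and> card e = 2"
    and p: "0 \<le> p" "p \<le> 1"
    and W: "\<And>x y. 0 \<le> p + U x y" "\<And>x y. p + U x y \<le> 1"
    and counts: "\<And>k. (\<Sum>F | F \<subseteq> E \<and> card F = k.
        \<integral>x. (\<Prod>e\<in>F. p + edge_val U x e) * (\<Prod>e\<in>E - F. 1 - (p + edge_val U x e)) \<partial>vertex_space) =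
      (\<Sum>F | F \<subseteq> E \<and> card F = k. p ^ card F * (1 - p) ^ card (E - F))"
    and k: "0 < k"
  shows "(\<Sum>F | F \<subseteq> E \<and> card F = k. hom_density F) = 0"
proof -
  have finE: "finite E"
    using E by (intro finite_subset[of E "Pow I"]) (auto simp: finite_I)
  define m where "m = card E"
  \<comment> \<open>Applied at \<open>z\<close> to bring in \<open>counts\<close>, and at
    \<open>s\<close> to read off the coefficients.\<close>
  have by_card: "(\<Sum>F\<in>Pow E. z ^ card F * g F) = (\<Sum>k\<le>m. (\<Sum>F | F \<subseteq> E \<and> card F = k. g F) * z ^ k)"
    for z :: real and g
  proof -
    have "(\<Sum>F\<in>Pow E. z ^ card F * g F) =
        (\<Sum>k\<le>m. \<Sum>F | F \<in> Pow E \<and> card F = k. z ^ card F * g F)"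
      using finE by (intro sum.group[symmetric]) (auto simp: m_def intro: card_mono)
    then show ?thesis by (simp add: sum_distrib_left mult.commute)
  qed
  have [measurable]: "(\<lambda>x. edge_val U x e) \<in> borel_measurable vertex_space" if "e \<in> E" for e
    using E[OF that] by (intro edge_val_meas) auto
  define w where "w x e = p + edge_val U x e" for x e
  have w: "\<bar>w x e\<bar> \<le> 1" "\<bar>1 - w x e\<bar> \<le> 1" for x e
    using W[of "x (Min e)" "x (Max e)"] by (auto simp: w_def edge_val_def)
  have w_meas: "(\<lambda>x. w x e) \<in> borel_measurable vertex_space" if "e \<in> E" for e
    using that unfolding w_def by measurable
  have int_w: "integrable vertex_space (\<lambda>x. (\<Prod>e\<in>F. w x e) * (\<Prod>e\<in>E - F. 1 - w x e))" if "F \<subseteq> E" for F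
    using that
    by (intro integrable_vertex_space abs_mult_le_1 abs_prod_le_1 w borel_measurable_times
        borel_measurable_prod borel_measurable_diff borel_measurable_const w_meas) auto
  have int_u: "integrable vertex_space (\<lambda>x. \<Prod>e\<in>F. edge_val U x e)" if "F \<subseteq> E" for F
    using that by (intro integrable_vertex_space abs_prod_le_1 edge_val_bound borel_measurable_prod) auto
  have gen: "(\<Sum>k\<le>m. (\<Sum>F | F \<subseteq> E \<and> card F = k. hom_density F) * s ^ k) = 1"
    if s: "0 \<le> s" "s \<le> 1 / 2" for s
  proof -
    \<comment> \<open>The bound on \<open>s\<close> keeps the denominator \<open>1 - s * p\<close>
      positive even for \<open>p = 1\<close>.\<close>
    have "s * p \<le> 1 / 2 * 1" using s p by (intro mult_mono) auto
    then have pos: "0 < 1 - s * p" by simp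
    \<comment> \<open>The generating function of the edge count is evaluated at \<open>z\<close>, chosen so that
      \<open>z (p + u) + (1 - (p + u))\<close> is proportional to \<open>1 + s u\<close>.\<close>
    define z where "z = 1 + s / (1 - s * p)"
    define q where "q = 1 / (1 - s * p)"
    have q: "q \<noteq> 0" "z * p + (1 - p) = q" and zw: "z * (p + u) + (1 - (p + u)) = q * (1 + s * u)" for u
      using pos by (auto simp: z_def q_def field_simps)
    have "(\<Sum>F\<in>Pow E. z ^ card F * (\<integral>x. (\<Prod>e\<in>F. w x e) * (\<Prod>e\<in>E - F. 1 - w x e) \<partial>vertex_space)) =
        (\<integral>x. (\<Sum>F\<in>Pow E. z ^ card F * ((\<Prod>e\<in>F. w x e) * (\<Prod>e\<in>E - F. 1 - w x e))) \<partial>vertex_space)"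
      using int_w by (subst Bochner_Integration.integral_sum) auto
    \<comment> \<open>The sum over edge sets is the expansion of a product of binomials. After the
      substitution the product is expanded again, now with second summand 1, which leaves only the
      factors over \<open>F\<close>.\<close>
    also have "\<dots> = (\<integral>x. (\<Prod>e\<in>E. z * w x e + (1 - w x e)) \<partial>vertex_space)"
      by (simp add: prod_add[OF finE] prod.distrib mult.assoc)
    also have "\<dots> = (\<integral>x. q ^ m * (\<Prod>e\<in>E. s * edge_val U x e + 1) \<partial>vertex_space)"
      by (simp add: w_def zw prod.distrib m_def) (simp add: add.commute)
    also have "\<dots> = (\<integral>x. q ^ m * (\<Sum>F\<in>Pow E. s ^ card F * (\<Prod>e\<in>F. edge_val U x e)) \<partial>vertex_space)"
      by (simp add: prod_add[OF finE] prod.distrib)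
    also have "\<dots> = q ^ m * (\<Sum>F\<in>Pow E. s ^ card F * hom_density F)"
      using int_u by (simp add: Bochner_Integration.integral_sum hom_density_def)
    finally have 1: "(\<Sum>F\<in>Pow E. z ^ card F * (\<integral>x. (\<Prod>e\<in>F. w x e) * (\<Prod>e\<in>E - F. 1 - w x e) \<partial>vertex_space)) =
        q ^ m * (\<Sum>F\<in>Pow E. s ^ card F * hom_density F)" .
    have "(\<Sum>F\<in>Pow E. z ^ card F * (p ^ card F * (1 - p) ^ card (E - F))) = (\<Prod>e\<in>E. z * p + (1 - p))"
      using prod_add[OF finE, of "\<lambda>_. z * p" "\<lambda>_. 1 - p"]
      by (simp add: power_mult_distrib mult.assoc)
    also have "\<dots> = q ^ m" by (simp add: q(2) m_def)
    finally have 2: "(\<Sum>F\<in>Pow E. z ^ card F * (p ^ card F * (1 - p) ^ card (E - F))) = q ^ m" .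
    have "q ^ m * (\<Sum>F\<in>Pow E. s ^ card F * hom_density F) = q ^ m"
      using 1 2 counts unfolding by_card w_def by simp
    then show ?thesis using q(1) by (simp add: by_card)
  qed
  show ?thesis
  proof (cases "k \<le> m")
    case True
    \<comment> \<open>Subtracting the constant 1 makes every point of the interval a root, and a
      polynomial with infinitely many roots has zero coefficients.\<close>
    define c where "c k = (\<Sum>F | F \<subseteq> E \<and> card F = k. hom_density F) - (if k = 0 then 1 else 0)" for k
    have "(\<Sum>k\<le>m. c k * s ^ k) = 0" if "s \<in> {0..1 / 2}" for s
    proof -
      have "(\<Sum>k\<le>m. (if k = 0 then 1 else 0) * s ^ k) = (\<Sum>k\<le>m. if k = 0 then 1 else 0)"
        by (intro sum.cong) auto
      then show ?thesis
        using gen[of s] that by (simp add: c_def left_diff_distrib sum_subtractf)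
    qed
    then have "{0..1 / 2 :: real} \<subseteq> {s. (\<Sum>k\<le>m. c k * s ^ k) = 0}" by auto
    then have "infinite {s. (\<Sum>k\<le>m. c k * s ^ k) = 0}"
      by (rule infinite_super) simp
    then have "c k = 0" using True polyfun_finite_roots[of c m] by blast
    then show ?thesis using k by (simp add: c_def)
  next
    case False
    then have "{F. F \<subseteq> E \<and> card F = k} = {}" using card_mono[OF finE] by (auto simp: m_def)
    then show ?thesis by (metis sum.empty)
  qed
qed

end

subsection \<open>Sampling from graphons\<close>

lemma prod_edge_pairs:
  assumes "\<And>e. e \<in> F \<Longrightarrow> card e = 2"
  shows "(\<Prod>(i, j)\<in>edge_pairs F. g i j) = (\<Prod>e\<in>F. g (Min e) (Max e))"
proof (rule prod.reindex_bij_witness[of _ "\<lambda>e. (Min e, Max e)" "\<lambda>(i, j). {i, j}"])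
  fix e assume "e \<in> F"
  then obtain a b where "e = {a, b}" "a < b"
    using assms by (metis card_2_iff insert_commute linorder_neqE_nat)
  then show "(case (Min e, Max e) of (i, j) \<Rightarrow> {i, j}) = e" "(Min e, Max e) \<in> edge_pairs F"
    using \<open>e \<in> F\<close> by (auto simp: edge_pairs_def)
qed (auto simp: edge_pairs_def)

lemma sampling_AE_cong:
  fixes V W :: "real \<Rightarrow> real \<Rightarrow> real" and n :: nat
  defines "M \<equiv> restrict_space lborel {0..1}"
  assumes E: "simple_graph n E" and F: "F \<subseteq> E"
    and V: "(\<lambda>(x, y). V x y) \<in> borel_measurable (M \<Otimes>\<^sub>M M)"
    and ae: "AE z in M \<Otimes>\<^sub>M M. V (fst z) (snd z) = W (fst z) (snd z)"
  shows "sampling n E W F =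
    (\<integral>x. (\<Prod>e\<in>F. edge_val V x e) * (\<Prod>e\<in>E - F. 1 - edge_val V x e) \<partial>(\<Pi>\<^sub>M i\<in>{1..n}. M))"
proof -
  interpret prob_space M
    unfolding M_def by (rule prob_space_restrict_space) auto
  have edge: "Min e \<in> {1..n}" "Max e \<in> {1..n}" "Min e \<noteq> Max e" if "e \<in> E" for e
  proof -
    have e: "e \<subseteq> {1..n}" "card e = 2" using E that by (auto simp: simple_graph_def)
    then obtain a b where "e = {a, b}" "a < b"
      by (metis card_2_iff insert_commute linorder_neqE_nat)
    then show "Min e \<in> {1..n}" "Max e \<in> {1..n}" "Min e \<noteq> Max e" using e(1) by auto
  qed
  have card: "card e = 2" if "e \<in> E" for e
    using E that by (auto simp: simple_graph_def)
  have finE: "finite E"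
    using E by (intro finite_subset[of E "Pow {1..n}"]) (auto simp: simple_graph_def)
  note [measurable] = V
  have meas: "(\<lambda>x. edge_val V x e) \<in> borel_measurable (\<Pi>\<^sub>M i\<in>{1..n}. M)" if "e \<in> E" for e
  proof -
    note [measurable] = edge(1,2)[OF that]
    show ?thesis unfolding edge_val_def by measurable
  qed
  have "AE x in (\<Pi>\<^sub>M i\<in>{1..n}. M). edge_val V x e = edge_val W x e" if "e \<in> E" for e
  proof -
    have "AE z in distr (\<Pi>\<^sub>M i\<in>{1..n}. M) (M \<Otimes>\<^sub>M M) (\<lambda>x. (x (Min e), x (Max e))).
        V (fst z) (snd z) = W (fst z) (snd z)"
      unfolding distr_PiM_two_components[OF edge[OF that]] by (rule ae)
    from AE_distrD[OF _ this] show ?thesis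
      using edge[OF that] by (simp add: edge_val_def)
  qed
  then have all: "AE x in (\<Pi>\<^sub>M i\<in>{1..n}. M). \<forall>e\<in>E. edge_val V x e = edge_val W x e"
    by (intro AE_finite_allI[OF finE])
  have "sampling n E W F =
      (\<integral>x. (\<Prod>e\<in>F. edge_val W x e) * (\<Prod>e\<in>E - F. 1 - edge_val W x e) \<partial>completion (\<Pi>\<^sub>M i\<in>{1..n}. M))"
    using card F unfolding sampling_def unit_cube_def M_def edge_val_def
    by (subst (1 2) prod_edge_pairs) auto
  also have "\<dots> = (\<integral>x. (\<Prod>e\<in>F. edge_val V x e) * (\<Prod>e\<in>E - F. 1 - edge_val V x e) \<partial>(\<Pi>\<^sub>M i\<in>{1..n}. M))"
  proof (rule integral_completion_AE)
    show "(\<lambda>x. (\<Prod>e\<in>F. edge_val V x e) * (\<Prod>e\<in>E - F. 1 - edge_val V x e)) \<in> borel_measurable (\<Pi>\<^sub>M i\<in>{1..n}. M)"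
      using F by (intro borel_measurable_times borel_measurable_prod borel_measurable_diff
        borel_measurable_const meas) auto
    show "AE x in (\<Pi>\<^sub>M i\<in>{1..n}. M).
        (\<Prod>e\<in>F. edge_val V x e) * (\<Prod>e\<in>E - F. 1 - edge_val V x e) =
        (\<Prod>e\<in>F. edge_val W x e) * (\<Prod>e\<in>E - F. 1 - edge_val W x e)"
      using all
    proof eventually_elim
      case (elim x)
      then show ?case using F by (intro arg_cong2[where f = "(*)"] prod.cong) auto
    qed
  qed
  finally show ?thesis .
qed

section \<open>The unit square and Borel versions of graphons\<close>

lemma unit_square_sets: "{0..1 :: real} \<times> {0..1 :: real} \<in> sets lborel"
  by (simp add: borel_closed closed_Times)

lemma unit_square_measure:
  "restrict_space lborel {0..1} \<Otimes>\<^sub>M restrict_space lborel {0..1} =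
    restrict_space lborel ({0..1 :: real} \<times> {0..1 :: real})"
  unfolding lborel_prod[symmetric] by (rule pair_restrict_space) (auto intro: sigma_finite_lborel)

text \<open>Extend \<open>W\<close> by 0, take a Borel function \<open>g\<close> equal to it almost
  everywhere, then average \<open>g\<close> with its transpose and clamp to the unit interval. This
  restores symmetry and bounds everywhere without changing values where \<open>g\<close> agrees with
  \<open>W\<close> at both \<open>(x, y)\<close> and \<open>(y, x)\<close>.\<close>

lemma graphon_borel_version:
  fixes W :: "real \<Rightarrow> real \<Rightarrow> real"
  defines "M \<equiv> restrict_space lborel {0..1}"
  assumes W: "graphon W"
  obtains V :: "real \<Rightarrow> real \<Rightarrow> real" where "(\<lambda>(x, y). V x y) \<in> borel_measurable (M \<Otimes>\<^sub>M M)"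
    "\<And>x y. V x y = V y x" "\<And>x y. 0 \<le> V x y" "\<And>x y. V x y \<le> 1"
    "AE z in M \<Otimes>\<^sub>M M. V (fst z) (snd z) = W (fst z) (snd z)"
proof -
  interpret prob_space M
    unfolding M_def by (rule prob_space_restrict_space) auto
  interpret pair: pair_prob_space M M
    by unfold_locales
  let ?S = "{0..1 :: real} \<times> {0..1 :: real}"
  note S = unit_square_sets
  note MM = unit_square_measure[folded M_def]
  have "(\<lambda>z. indicator ?S z *\<^sub>R (case z of (x, y) \<Rightarrow> W x y)) \<in> borel_measurable lebesgue"
    using W S unfolding graphon_def
    by (subst borel_measurable_restrict_space_iff[symmetric]) auto
  from completion_ex_borel_measurable_real[OF this] obtain g
    where g: "g \<in> borel_measurable lborel"
      and ae: "AE z in lborel. indicator ?S z *\<^sub>R (case z of (x, y) \<Rightarrow> W x y) = g z" by blast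
  have g_meas[measurable]: "g \<in> borel_measurable (M \<Otimes>\<^sub>M M)"
    unfolding MM by (rule measurable_restrict_space1[OF g])
  have ae1: "AE z in M \<Otimes>\<^sub>M M. g z = W (fst z) (snd z)"
    unfolding MM using S by (subst AE_restrict_space_iff) (auto intro: eventually_mono[OF ae] split: prod.splits)
  \<comment> \<open>Swapping coordinates preserves the product measure, so agreement also holds
    almost surely at the transposed point.\<close>
  have "AE z in distr (M \<Otimes>\<^sub>M M) (M \<Otimes>\<^sub>M M) (\<lambda>(x, y). (y, x)). g z = W (fst z) (snd z)"
    unfolding pair.distr_pair_swap[symmetric] by (rule ae1)
  from AE_distrD[OF _ this] have ae2: "AE z in M \<Otimes>\<^sub>M M. g (snd z, fst z) = W (snd z) (fst z)"
    by (simp add: case_prod_beta)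
  define V where "V x y = max 0 (min 1 ((g (x, y) + g (y, x)) / 2))" for x y
  show thesis
  proof (rule that[of V])
    show "(\<lambda>(x, y). V x y) \<in> borel_measurable (M \<Otimes>\<^sub>M M)" unfolding V_def by measurable
    show "AE z in M \<Otimes>\<^sub>M M. V (fst z) (snd z) = W (fst z) (snd z)"
      using ae1 ae2 AE_space
    proof eventually_elim
      case (elim z)
      then have "fst z \<in> {0..1}" "snd z \<in> {0..1}"
        by (auto simp: M_def space_pair_measure space_restrict_space)
      then show ?case using elim W by (auto simp: V_def graphon_def)
    qed
  qed (auto simp: V_def add.commute)
qed

theorem theorem1:
  fixes n :: nat and E :: "nat set set" and W :: "real \<Rightarrow> real \<Rightarrow> real" and p :: real
  assumes "simple_graph n E"
    and "contains_C4 E"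
    and "graphon W"
    and "p \<in> {0..1}"
    and "edge_count n E W = edge_count n E (\<lambda>x y. p)"
  shows "AE (x, y) in lebesgue_on ({0..1} \<times> {0..1}). W x y = p"
proof -
  define M :: "real measure" where "M = restrict_space lborel {0..1}"
  interpret prob_space M
    unfolding M_def by (rule prob_space_restrict_space) auto
  obtain V where V: "(\<lambda>(x, y). V x y) \<in> borel_measurable (M \<Otimes>\<^sub>M M)"
    "\<And>x y. V x y = V y x" "\<And>x y. 0 \<le> V x y" "\<And>x y. V x y \<le> 1"
    and VW: "AE z in M \<Otimes>\<^sub>M M. V (fst z) (snd z) = W (fst z) (snd z)"
    using graphon_borel_version[OF assms(3)] unfolding M_def by blast
  have p: "0 \<le> p" "p \<le> 1" using assms(4) by auto
  note [measurable] = V(1)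
  define U where "U x y = V x y - p" for x y
  interpret symmetric_kernel M U "{1..n}"
  proof
    show "(\<lambda>(x, y). U x y) \<in> borel_measurable (M \<Otimes>\<^sub>M M)" unfolding U_def by measurable
    show "U x y = U y x" for x y using V(2) by (simp add: U_def)
    show "\<bar>U x y\<bar> \<le> 1" for x y using V(3,4)[of x y] p unfolding U_def by linarith
  qed simp
  have E: "e \<subseteq> {1..n} \<and> card e = 2" if "e \<in> E" for e
    using assms(1) that by (auto simp: simple_graph_def)
  have V_val: "edge_val V x e = p + edge_val U x e" for x e
    by (simp add: edge_val_def U_def)
  have W_sampling: "sampling n E W F =
      (\<integral>x. (\<Prod>e\<in>F. p + edge_val U x e) * (\<Prod>e\<in>E - F. 1 - (p + edge_val U x e)) \<partial>vertex_space)"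
    if "F \<subseteq> E" for F
    using sampling_AE_cong[OF assms(1) that V(1)[unfolded M_def] VW[unfolded M_def]]
    by (simp add: M_def[symmetric] V_val)
  \<comment> \<open>The constant kernel is its own Borel version, and its integrand is constant on a
    space of mass 1.\<close>
  have p_sampling: "sampling n E (\<lambda>x y. p) F = p ^ card F * (1 - p) ^ card (E - F)" if "F \<subseteq> E" for F
    using sampling_AE_cong[OF assms(1) that, of "\<lambda>x y. p" "\<lambda>x y. p"]
      PI.P.prob_space by (simp add: M_def[symmetric] edge_val_def)
  have counts: "(\<Sum>F | F \<subseteq> E \<and> card F = k.
        \<integral>x. (\<Prod>e\<in>F. p + edge_val U x e) * (\<Prod>e\<in>E - F. 1 - (p + edge_val U x e)) \<partial>vertex_space) =
      (\<Sum>F | F \<subseteq> E \<and> card F = k. p ^ card F * (1 - p) ^ card (E - F))" for k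
  proof -
    have "(\<Sum>F | F \<subseteq> E \<and> card F = k. sampling n E W F) =
        (\<Sum>F | F \<subseteq> E \<and> card F = k. sampling n E (\<lambda>x y. p) F)"
      using fun_cong[OF assms(5), of k] by (simp add: edge_count_def)
    moreover have "(\<Sum>F | F \<subseteq> E \<and> card F = k. sampling n E W F) =
        (\<Sum>F | F \<subseteq> E \<and> card F = k.
          \<integral>x. (\<Prod>e\<in>F. p + edge_val U x e) * (\<Prod>e\<in>E - F. 1 - (p + edge_val U x e)) \<partial>vertex_space)"
      by (intro sum.cong refl W_sampling) auto
    moreover have "(\<Sum>F | F \<subseteq> E \<and> card F = k. sampling n E (\<lambda>x y. p) F) =
        (\<Sum>F | F \<subseteq> E \<and> card F = k. p ^ card F * (1 - p) ^ card (E - F))"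
      by (intro sum.cong refl p_sampling) auto
    ultimately show ?thesis by simp
  qed
  have zero: "(\<Sum>F | F \<subseteq> E \<and> card F = k. hom_density F) = 0" if "0 < k" for k
    using V(3,4) by (intro hom_density_sum_eq_0[OF E p _ _ counts that]) (auto simp: U_def)
  have "AE z in M \<Otimes>\<^sub>M M. U (fst z) (snd z) = 0"
    by (rule AE_zero_if_hom_density_sums_zero[OF E assms(2) zero zero]) simp_all
  with VW have "AE z in M \<Otimes>\<^sub>M M. W (fst z) (snd z) = p"
    by eventually_elim (auto simp: U_def)
  then have ae: "AE z in restrict_space lborel ({0..1} \<times> {0..1}). W (fst z) (snd z) = p"
    unfolding unit_square_measure[folded M_def] .
  \<comment> \<open>The goal restricts the completed measure, so the restriction is first undone,
    then the measure is completed and restricted again.\<close>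
  have "AE z in lborel. z \<in> {0..1} \<times> {0..1} \<longrightarrow> W (fst z) (snd z) = p"
    using ae unit_square_sets by (subst (asm) AE_restrict_space_iff) auto
  from AE_completion[OF this] show ?thesis
    using unit_square_sets by (subst AE_restrict_space_iff) (auto simp: case_prod_beta)
qed

end
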